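(* Let $0<a_1<b_1<a_2<b_2<\cdots$ and $c_i>0$ $(i=1,2,\ldots)$ be sequences of real numbers such that $\lim_{i\to\infty}a_i=\lim_{i\to\infty}b_i=+\infty$. Let $n>1$ be an integer and $$K=\bigcup_{i=1}^\infty\left(b_i\overline{\mathbb{D}}^{\,n-1}\setminus a_i\mathbb{D}^{n-1}\right)\times c_i\overline{\mathbb{D}}\subset\mathbb{C}^n.$$ Then there exists a Fatou-Bieberbach domain $\Omega\subset\mathbb{C}^n\setminus K$.
   Context: $\mathbb{D}=\{\zeta\in\mathbb{C}:|\zeta|<1\}$ and $\overline{\mathbb{D}}=\{\zeta\in\mathbb{C}:|\zeta|\le 1\}$; $\mathbb{D}^{n-1}$ and $\overline{\mathbb{D}}^{\,n-1}$ are the open and closed unit polydisks in $\mathbb{C}^{n-1}$, and $tA=\{ta:a\in A\}$ for $t>0$. A Fatou-Bieberbach domain in $\mathbb{C}^n$ is a proper subdomain $\Omega\subsetneq\mathbb{C}^n$ that is the image of an injective holomorphic map $\mathbb{C}^n\to\mathbb{C}^n$ (equivalently, is biholomorphic to $\mathbb{C}^n$). *)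

theory Defs
  imports "HOL-Analysis.Analysis"
begin

text \<open>Holomorphic maps \<open>\<complex>\<^sup>n \<rightarrow> \<complex>\<^sup>m\<close> are those whose real Frechet derivative exists at every
  point and is complex linear: \<open>(*s)\<close> is multiplication of a vector by a complex scalar,
  whereas \<open>has_derivative\<close> only provides real linearity.\<close>

definition holomorphic_map :: "(complex ^ 'n \<Rightarrow> complex ^ 'm) \<Rightarrow> bool" where
  "holomorphic_map F \<longleftrightarrow>
     (\<forall>z. \<exists>F'. (F has_derivative F') (at z) \<and> Vector_Spaces.linear (*s) (*s) F')"

definition fatou_bieberbach_domain :: "(complex ^ 'n) set \<Rightarrow> bool" where
  "fatou_bieberbach_domain \<Omega> \<longleftrightarrow>
     open \<Omega> \<and> connected \<Omega> \<and> \<Omega> \<noteq> UNIV \<and>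
     (\<exists>F :: complex ^ 'n \<Rightarrow> complex ^ 'n. holomorphic_map F \<and> inj F \<and> range F = \<Omega>)"

definition open_polydisk :: "(complex ^ 'm) set" where
  "open_polydisk = {z. \<forall>j. z $ j \<in> ball 0 1}"

definition closed_polydisk :: "(complex ^ 'm) set" where
  "closed_polydisk = {z. \<forall>j. z $ j \<in> cball 0 1}"

text \<open>With \<open>n - 1 = CARD('m)\<close>, the index type \<open>'m option\<close> has \<open>n\<close> elements: the coordinates
  \<open>Some j\<close> are the first \<open>n - 1\<close> ones and \<open>None\<close> is the last one.  The following is the
  product \<open>A \<times> B\<close> under the resulting identification of \<open>\<complex>\<^sup>n\<close> with \<open>\<complex>\<^sup>n\<^sup>-\<^sup>1 \<times> \<complex>\<close>.
  Since types are nonempty, \<open>n > 1\<close> holds automatically, and every \<open>n > 1\<close> occurs.\<close>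

definition times_last ::
    "(complex ^ 'm) set \<Rightarrow> complex set \<Rightarrow> (complex ^ ('m option)) set" where
  "times_last A B = {z. (\<chi> j. z $ Some j) \<in> A \<and> z $ None \<in> B}"

end

theory Submission
  imports Defs "HOL-Complex_Analysis.Complex_Analysis"
begin

text \<open>The domain is \<open>\<Theta> (\<Psi> (\<complex>\<^sup>n))\<close>, where \<open>\<Psi>\<close> is an injective entire map whose image avoids a large region
  of simple shape, and \<open>\<Theta>\<close> is an automorphism whose inverse moves \<open>K\<close> into that region.

  Put the coordinates in a line \<open>x\<^sub>0, \<dots>, x\<^sub>n\<^sub>-\<^sub>1\<close>, the last one being the factor of the discs.  The region
  consists of the points at which some coordinate \<open>x\<^sub>k\<close> other than \<open>x\<^sub>0\<close> has modulus at least
  \<open>max (R, \<bar>x\<^sub>0\<bar>)\<close> times a constant that depends on \<open>k\<close>.  A cyclic shift of the coordinates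
  combined with a quadratic shear, a Henon map in dimension two, has an attracting fixed point at the
  origin and never leads out of the region, because what dominates is either just passed on or gets
  squared.  The basin of attraction is therefore disjoint from the region.  The linear part at the fixed
  point is a multiple of a permutation matrix, so all its eigenvalues have the same modulus, there are no
  resonances, and the map can be linearised: with \<open>E\<close> the inverse Henon map and \<open>L\<close> the
  linear part of the Henon map itself, the limit \<open>\<Psi>\<close> of \<open>E\<^sup>m \<circ> L\<^sup>m\<close> exists on all of
  \<open>\<complex>\<^sup>n\<close> and maps into the basin, because \<open>\<Psi> = E \<circ> \<Psi> \<circ> L\<close>
  (\<open>linearising_map\<close>, \<open>entire_embedding_avoiding_dominated_region\<close>).

  For \<open>K\<close>, note that a point in the \<open>i\<close>-th piece has some coordinate, not the last one, with modulus
  between \<open>a\<^sub>i\<close> and \<open>b\<^sub>i\<close>, while the other coordinates are bounded in terms of \<open>b\<^sub>i\<close> and \<open>c\<^sub>i\<close>.  Thanks to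
  the gaps between the annuli, some entire function \<open>f\<close> of one variable is as large as desired on each of
  them (\<open>entire_function_large_on_annuli\<close>).  Adding \<open>f (z\<^sub>k)\<close> to
  \<open>z\<^sub>k\<^sub>+\<^sub>1\<close> for all \<open>k\<close> simultaneously leaves \<open>z\<^sub>0\<close> alone and makes another coordinate huge, so \<open>K\<close> is
  moved into the region.  This map is triangular, hence has a holomorphic inverse \<open>\<Theta>\<close>
  (\<open>triangular_automorphism\<close>).\<close>

section \<open>Entire maps between complex coordinate spaces\<close>

abbreviation complex_linear :: "(complex ^ 'n \<Rightarrow> complex ^ 'm) \<Rightarrow> bool" where
  "complex_linear \<equiv> Vector_Spaces.linear (*s) (*s)"

lemma complex_linear_iff:
  fixes f :: "complex ^ 'n \<Rightarrow> complex ^ 'm"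
  shows "complex_linear f \<longleftrightarrow>
    (\<forall>x y. f (x + y) = f x + f y) \<and> (\<forall>c x. f (c *s x) = c *s f x)"
  by (simp add: Vector_Spaces.linear_iff vec.vector_space_axioms)

text \<open>A real scalar \<open>r\<close> acts as the complex scalar \<open>of_real r\<close>, so complex linearity includes real
  linearity, and in finite dimension linear maps are bounded.\<close>

lemma complex_linear_imp_bounded_linear:
  fixes f :: "complex ^ 'n \<Rightarrow> complex ^ 'm"
  assumes "complex_linear f"
  shows "bounded_linear f"
proof -
  have "linear f"
  proof (rule linearI)
    show "f (x + y) = f x + f y" for x y
      using assms by (simp add: complex_linear_iff)
    have scale: "r *\<^sub>R x = complex_of_real r *s x" for r and x :: "complex ^ 'k"
      by (simp add: vec_eq_iff) (simp add: scaleR_conv_of_real)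
    show "f (r *\<^sub>R x) = r *\<^sub>R f x" for r x
      using assms by (simp add: complex_linear_iff scale)
  qed
  then show ?thesis
    by (simp add: linear_conv_bounded_linear)
qed

lemma complex_linear_compose:
  assumes "complex_linear f" "complex_linear g"
  shows "complex_linear (\<lambda>x. g (f x))"
  using assms by (simp add: complex_linear_iff)

lemma holomorphic_map_compose:
  assumes "holomorphic_map f" "holomorphic_map g"
  shows "holomorphic_map (\<lambda>x. g (f x))"
  unfolding holomorphic_map_def
proof
  fix z
  obtain f' where f': "(f has_derivative f') (at z)" "complex_linear f'"
    using assms(1) unfolding holomorphic_map_def by blast
  obtain g' where g': "(g has_derivative g') (at (f z))" "complex_linear g'"
    using assms(2) unfolding holomorphic_map_def by blast
  show "\<exists>F'. ((\<lambda>x. g (f x)) has_derivative F') (at z) \<and> complex_linear F'"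
    using has_derivative_compose[OF f'(1) g'(1)] complex_linear_compose[OF f'(2) g'(2)] by blast
qed

lemma holomorphic_map_funpow:
  fixes f :: "complex ^ 'n \<Rightarrow> complex ^ 'n"
  shows "holomorphic_map f \<Longrightarrow> holomorphic_map (f ^^ k)"
proof (induction k)
  case 0
  have "complex_linear (\<lambda>h::complex ^ 'n. h)" by (simp add: complex_linear_iff)
  then show ?case
    unfolding holomorphic_map_def funpow.simps(1) id_def
    by (intro allI exI[of _ "\<lambda>h. h"] conjI has_derivative_ident)
next
  case (Suc k)
  from holomorphic_map_compose[OF Suc.IH[OF Suc.prems] Suc.prems] show ?case
    by (simp add: o_def)
qed

lemma holomorphic_map_continuous_on: "holomorphic_map f \<Longrightarrow> continuous_on S f"
  unfolding holomorphic_map_def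
  by (meson continuous_at_imp_continuous_on has_derivative_continuous)

text \<open>An injective entire map is open by invariance of domain, so no Jacobian has to be examined: only
  properness of the image remains to be checked.\<close>

lemma fatou_bieberbach_domain_range:
  fixes F :: "complex ^ 'n \<Rightarrow> complex ^ 'n"
  assumes "holomorphic_map F" "inj F" "range F \<noteq> UNIV"
  shows "fatou_bieberbach_domain (range F)"
proof -
  have "open (range F)"
    using assms by (intro invariance_of_domain holomorphic_map_continuous_on) auto
  moreover have "connected (range F)"
    using assms by (intro connected_continuous_image holomorphic_map_continuous_on) auto
  ultimately show ?thesis
    unfolding fatou_bieberbach_domain_def using assms by blast
qed

section \<open>Linearising an expanding quadratic map\<close>

text \<open>The explicit error bound is what is used later: it makes the convergence of a sequence of maps
  uniform as soon as the increments are bounded uniformly.\<close>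

lemma geometric_increments_converge:
  fixes u :: "nat \<Rightarrow> 'a::banach"
  assumes q: "0 \<le> q" "q < 1" and step: "\<And>m. norm (u (Suc m) - u m) \<le> A * q ^ m"
  obtains l where "u \<longlonglongrightarrow> l" "\<And>m. norm (u m - l) \<le> A * q ^ m / (1 - q)"
proof -
  have A: "0 \<le> A"
    using step[of 0] by (simp add: order_trans[OF norm_ge_zero])
  have tail: "norm (u (m + k) - u m) \<le> A * q ^ m * (1 - q ^ k) / (1 - q)" for m k
  proof (induction k)
    case (Suc k)
    have "norm (u (m + Suc k) - u m) \<le> norm (u (m + Suc k) - u (m + k)) + norm (u (m + k) - u m)"
      using norm_triangle_ineq[of "u (m + Suc k) - u (m + k)" "u (m + k) - u m"] by simp
    also have "\<dots> \<le> A * q ^ (m + k) + A * q ^ m * (1 - q ^ k) / (1 - q)"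
      using step[of "m + k"] Suc by simp
    also have "\<dots> = A * q ^ m * (1 - q ^ Suc k) / (1 - q)"
      using q by (simp add: field_simps power_add)
    finally show ?case .
  qed simp
  have tail': "norm (u (m + k) - u m) \<le> A * q ^ m / (1 - q)" for m k
  proof -
    have "A * q ^ m * (1 - q ^ k) \<le> A * q ^ m * 1"
      using A q by (intro mult_left_mono) auto
    then have "A * q ^ m * (1 - q ^ k) / (1 - q) \<le> A * q ^ m / (1 - q)"
      using q by (intro divide_right_mono) auto
    with tail show ?thesis by (rule order_trans)
  qed
  have "summable (\<lambda>m. u (Suc m) - u m)"
    using q by (intro summable_comparison_test'[OF summable_mult[OF summable_geometric], of q 0 _ A])
               (use step in auto)
  then have "convergent (\<lambda>n. \<Sum>m<n. u (Suc m) - u m)"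
    by (simp add: summable_iff_convergent)
  then have "convergent (\<lambda>n. (\<Sum>m<n. u (Suc m) - u m) + u 0)"
    by (rule convergent_add[OF _ convergent_const])
  then have "convergent u"
    by (simp add: sum_lessThan_telescope)
  then obtain l where l: "u \<longlonglongrightarrow> l"
    by (auto simp: convergent_def)
  have "norm (u m - l) \<le> A * q ^ m / (1 - q)" for m
  proof -
    have "(\<lambda>k. norm (u (k + m) - u m)) \<longlonglongrightarrow> norm (l - u m)"
      by (intro tendsto_intros LIMSEQ_ignore_initial_segment l)
    then have "norm (l - u m) \<le> A * q ^ m / (1 - q)"
      by (rule LIMSEQ_le_const2) (use tail'[of m] in \<open>auto simp: add.commute\<close>)
    then show ?thesis by (simp add: norm_minus_commute)
  qed
  with l that show ?thesis by blast
qed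

text \<open>The linear map \<open>M\<close> doubles norms and \<open>L\<close> is its inverse.  The injective map
  \<open>x \<mapsto> M x - B x x\<close> is then expanding near its fixed point \<open>0\<close>.  It turns out to be conjugate to its
  linear part \<open>M\<close> on the whole range of an injective entire map, which satisfies
  \<open>\<Psi> (M z) = quad_map (\<Psi> z)\<close>.  The reason is that all eigenvalues of \<open>M\<close> have the same
  modulus \<open>2\<close> while quadratic terms scale by \<open>4\<close>, so there are no resonances.\<close>

locale quadratic_expansion =
  fixes L M :: "complex ^ 'n \<Rightarrow> complex ^ 'n"
    and B :: "complex ^ 'n \<Rightarrow> complex ^ 'n \<Rightarrow> complex ^ 'n"
  assumes L: "complex_linear L" and M: "complex_linear M"
    and norm_L: "norm (L x) = norm x / 2" and norm_M: "norm (M x) = 2 * norm x"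
    and M_L: "M (L x) = x"
    and B_bilinear: "bounded_bilinear B"
    and B_left: "complex_linear (\<lambda>x. B x y)" and B_right: "complex_linear (B x)"
    and norm_B: "norm (B x y) \<le> norm x * norm y"
    and inj_quad_map: "inj (\<lambda>x. M x - B x x)"
begin

definition quad_map :: "complex ^ 'n \<Rightarrow> complex ^ 'n" where
  "quad_map x = M x - B x x"

text \<open>\<open>approx m\<close> is \<open>(quad_map ^^ m) \<circ> (L ^^ m)\<close>; the limit of this sequence solves
  the conjugacy equation.  Peeling off the outermost \<open>quad_map\<close> and the innermost \<open>L\<close> makes all the
  following estimates one-step inductions that replace \<open>z\<close> by the shorter vector \<open>L z\<close>.\<close>

primrec approx :: "nat \<Rightarrow> complex ^ 'n \<Rightarrow> complex ^ 'n" where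
  "approx 0 z = z"
| "approx (Suc m) z = quad_map (approx m (L z))"

text \<open>The Frechet derivative of \<open>approx m\<close> at \<open>z\<close>, in the form that the chain rule gives.\<close>

primrec approx_deriv :: "nat \<Rightarrow> complex ^ 'n \<Rightarrow> complex ^ 'n \<Rightarrow> complex ^ 'n" where
  "approx_deriv 0 z h = h"
| "approx_deriv (Suc m) z h = M (approx_deriv m (L z) (L h))
     - (B (approx m (L z)) (approx_deriv m (L z) (L h)) + B (approx_deriv m (L z) (L h)) (approx m (L z)))"

lemma L_has_derivative: "(L has_derivative L) (at z)"
  by (rule bounded_linear_imp_has_derivative[OF complex_linear_imp_bounded_linear[OF L]])

lemma quad_map_has_derivative:
  "(quad_map has_derivative (\<lambda>h. M h - (B z h + B h z))) (at z)"
proof -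
  have "(M has_derivative M) (at z)"
    by (rule bounded_linear_imp_has_derivative[OF complex_linear_imp_bounded_linear[OF M]])
  moreover have "((\<lambda>x. B x x) has_derivative (\<lambda>h. B z h + B h z)) (at z)"
    by (rule bounded_bilinear.FDERIV[OF B_bilinear]) auto
  ultimately have "((\<lambda>x. M x - B x x) has_derivative (\<lambda>h. M h - (B z h + B h z))) (at z)"
    by (rule has_derivative_diff)
  then show ?thesis by (simp add: quad_map_def[abs_def])
qed

lemma quad_map_derivative_complex_linear: "complex_linear (\<lambda>h. M h - (B z h + B h z))"
  using M B_left[of z] B_right[of z] unfolding complex_linear_iff
  by (simp add: algebra_simps vec.scale_right_diff_distrib vec.scale_right_distrib)

lemma holomorphic_map_L: "holomorphic_map L"
  unfolding holomorphic_map_def using L_has_derivative L by blast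

lemma holomorphic_map_quad_map: "holomorphic_map quad_map"
  unfolding holomorphic_map_def using quad_map_has_derivative quad_map_derivative_complex_linear by blast

lemma approx_has_derivative: "(approx m has_derivative approx_deriv m z) (at z)"
proof (induction m arbitrary: z)
  case (Suc m)
  have "approx_deriv (Suc m) z = (\<lambda>h. M (approx_deriv m (L z) (L h))
      - (B (approx m (L z)) (approx_deriv m (L z) (L h)) + B (approx_deriv m (L z) (L h)) (approx m (L z))))"
    by (simp add: fun_eq_iff)
  moreover have "approx (Suc m) = (\<lambda>z. quad_map (approx m (L z)))"
    by (simp add: fun_eq_iff)
  ultimately show ?case
    using has_derivative_compose[OF has_derivative_compose[OF L_has_derivative Suc] quad_map_has_derivative, of z]
    by simp
next
  case 0
  have "approx 0 = (\<lambda>z. z)" "approx_deriv 0 z = (\<lambda>h. h)" by (simp_all add: fun_eq_iff)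
  then show ?case by simp
qed

lemma approx_deriv_complex_linear: "complex_linear (approx_deriv m z)"
proof (induction m arbitrary: z)
  case 0
  then show ?case by (simp add: complex_linear_iff)
next
  case (Suc m)
  have "complex_linear (\<lambda>h. approx_deriv m (L z) (L h))"
    by (rule complex_linear_compose[OF L Suc])
  from complex_linear_compose[OF this quad_map_derivative_complex_linear] show ?case
    by (simp add: complex_linear_iff)
qed

text \<open>The bound reproduces itself because it is quadratic in \<open>norm z\<close>: passing to \<open>L z\<close> divides it by
  \<open>4\<close>, whereas the outer linear map \<open>M\<close> only doubles it.  The spare factor \<open>1/2\<close> pays for the
  quadratic term.\<close>

lemma approx_near_identity:
  assumes "norm z \<le> 1/2"
  shows "norm (approx m z - z) \<le> (norm z)\<^sup>2"
  using assms
proof (induction m arbitrary: z)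
  case (Suc m)
  define w where "w = approx m (L z)"
  have Lz: "norm (L z) = norm z / 2" by (rule norm_L)
  have IH: "norm (w - L z) \<le> (norm z / 2)\<^sup>2"
    using Suc.IH[of "L z"] Suc.prems by (simp add: w_def Lz)
  have "norm w \<le> norm (L z) + norm (w - L z)"
    by (rule norm_triangle_sub)
  also have "\<dots> \<le> norm z / 2 + (norm z / 2)\<^sup>2"
    using IH Lz by simp
  also have "\<dots> \<le> norm z * (5/8)"
    using mult_left_mono[OF Suc.prems, of "norm z"] by (simp add: power2_eq_square)
  finally have w: "norm w \<le> norm z * (5/8)" .
  have "approx (Suc m) z - z = M (w - L z) - B w w"
    using linear_diff[OF bounded_linear.linear[OF complex_linear_imp_bounded_linear[OF M]]]
    by (simp add: quad_map_def w_def M_L)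
  then have "norm (approx (Suc m) z - z) \<le> norm (M (w - L z)) + norm (B w w)"
    by (simp add: norm_triangle_ineq4)
  also have "\<dots> \<le> 2 * (norm z / 2)\<^sup>2 + norm w * norm w"
    using IH norm_B[of w w] by (simp add: norm_M)
  also have "\<dots> \<le> 2 * (norm z / 2)\<^sup>2 + (norm z * (5/8)) * (norm z * (5/8))"
    using w by (intro add_mono mult_mono order_refl) auto
  also have "\<dots> \<le> (norm z)\<^sup>2"
    by (simp add: power2_eq_square)
  finally show ?case .
qed simp

lemma norm_approx_L:
  assumes "norm z \<le> 1/2"
  shows "norm (approx m (L z)) \<le> norm z * (5/8)"
proof -
  have "norm (approx m (L z)) \<le> norm (L z) + norm (approx m (L z) - L z)"
    by (rule norm_triangle_sub)
  also have "\<dots> \<le> norm z / 2 + (norm z / 2)\<^sup>2"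
    using approx_near_identity[of "L z" m] assms by (simp add: norm_L)
  also have "\<dots> \<le> norm z * (5/8)"
    using mult_left_mono[OF assms, of "norm z"] by (simp add: power2_eq_square)
  finally show ?thesis .
qed

text \<open>The same balance for derivatives: the bound is linear in both \<open>z\<close> and \<open>h\<close>, so that passing to
  \<open>L z\<close> and \<open>L h\<close> gains a factor \<open>1/4\<close> against the factor \<open>2\<close> of \<open>M\<close>.  The bound makes the limit a
  small Lipschitz perturbation of the identity near \<open>0\<close>, hence injective there.\<close>

lemma approx_deriv_near_identity:
  assumes "norm z \<le> 1/2"
  shows "norm (approx_deriv m z h - h) \<le> 2 * norm z * norm h"
  using assms
proof (induction m arbitrary: z h)
  case (Suc m)
  define w where "w = approx m (L z)"
  define k where "k = approx_deriv m (L z) (L h)"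
  have w: "norm w \<le> norm z * (5/8)"
    unfolding w_def by (rule norm_approx_L[OF Suc.prems])
  have IH: "norm (k - L h) \<le> norm z * norm h / 2"
    using Suc.IH[of "L z" "L h"] Suc.prems by (simp add: k_def norm_L)
  have "norm k \<le> norm (L h) + norm (k - L h)"
    by (rule norm_triangle_sub)
  also have "\<dots> \<le> norm h / 2 + norm z * norm h / 2"
    using IH by (simp add: norm_L)
  also have "\<dots> \<le> norm h * (3/4)"
    using mult_right_mono[OF Suc.prems, of "norm h"] by (simp add: algebra_simps)
  finally have k: "norm k \<le> norm h * (3/4)" .
  have wk: "norm w * norm k \<le> (norm z * (5/8)) * (norm h * (3/4))"
    using w k by (intro mult_mono) auto
  have "approx_deriv (Suc m) z h - h = M (k - L h) - (B w k + B k w)"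
    using linear_diff[OF bounded_linear.linear[OF complex_linear_imp_bounded_linear[OF M]]]
    by (simp add: w_def k_def M_L)
  also have "norm \<dots> \<le> norm (M (k - L h)) + (norm (B w k) + norm (B k w))"
    by (rule order_trans[OF norm_triangle_ineq4 add_left_mono[OF norm_triangle_ineq]])
  also have "\<dots> \<le> norm z * norm h + (norm w * norm k + norm k * norm w)"
    using IH norm_B[of w k] norm_B[of k w] unfolding norm_M by linarith
  also have "\<dots> \<le> norm z * norm h + 2 * ((norm z * (5/8)) * (norm h * (3/4)))"
    using wk by (simp add: mult.commute)
  also have "\<dots> \<le> 2 * norm z * norm h"
    by simp
  finally show ?case .
qed simp

text \<open>Both iterates are small, so \<open>quad_map\<close> is Lipschitz with constant \<open>3\<close> between them, and the weight
  \<open>(norm z)\<^sup>2\<close> contributes \<open>1/4\<close>: together the ratio \<open>3/4\<close>.\<close>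

lemma approx_increment:
  assumes "norm z \<le> 1/2"
  shows "norm (approx (Suc m) z - approx m z) \<le> (norm z)\<^sup>2 * (3/4) ^ m"
  using assms
proof (induction m arbitrary: z)
  case 0
  then show ?case using approx_near_identity[of z 1] by simp
next
  case (Suc m)
  define v w where "v = approx (Suc m) (L z)" and "w = approx m (L z)"
  have v: "norm v \<le> 1/2" and w: "norm w \<le> 1/2"
    using norm_approx_L[of z "Suc m"] norm_approx_L[of z m] Suc.prems unfolding v_def w_def by linarith+
  have IH: "norm (v - w) \<le> (norm z / 2)\<^sup>2 * (3/4) ^ m"
    using Suc.IH[of "L z"] Suc.prems unfolding v_def w_def by (simp add: norm_L)
  have "approx (Suc (Suc m)) z - approx (Suc m) z = M (v - w) - (B v (v - w) + B (v - w) w)"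
    using linear_diff[OF bounded_linear.linear[OF complex_linear_imp_bounded_linear[OF M]]]
    by (simp add: v_def w_def quad_map_def bounded_bilinear.diff_left[OF B_bilinear]
        bounded_bilinear.diff_right[OF B_bilinear])
  also have "norm \<dots>
      \<le> norm (M (v - w)) + (norm (B v (v - w)) + norm (B (v - w) w))"
    by (rule order_trans[OF norm_triangle_ineq4 add_left_mono[OF norm_triangle_ineq]])
  also have "\<dots> \<le> 2 * norm (v - w) + (norm v * norm (v - w) + norm (v - w) * norm w)"
    using norm_B[of v "v - w"] norm_B[of "v - w" w] unfolding norm_M by linarith
  also have "\<dots> \<le> 2 * norm (v - w) + (1/2 * norm (v - w) + norm (v - w) * (1/2))"
    using v w by (intro add_mono mult_mono) auto
  also have "\<dots> = 3 * norm (v - w)" by simp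
  also have "\<dots> \<le> 3 * ((norm z / 2)\<^sup>2 * (3/4) ^ m)"
    using IH by simp
  also have "\<dots> = (norm z)\<^sup>2 * (3/4) ^ Suc m"
    by (simp add: power2_eq_square)
  finally show ?case .
qed

text \<open>Derivatives are compared directly, since uniform convergence of the derivatives is what yields
  differentiability of the limit; complex linearity of the derivative then passes to the limit
  pointwise.\<close>

lemma approx_deriv_increment:
  assumes "norm z \<le> 1/2"
  shows "norm (approx_deriv (Suc m) z h - approx_deriv m z h) \<le> 2 * norm z * norm h * (3/4) ^ m"
  using assms
proof (induction m arbitrary: z h)
  case 0
  then show ?case using approx_deriv_near_identity[of z 1 h] by simp
next
  case (Suc m)
  define v w where "v = approx (Suc m) (L z)" and "w = approx m (L z)"
  define k l where "k = approx_deriv (Suc m) (L z) (L h)" and "l = approx_deriv m (L z) (L h)"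
  define P where "P = norm z * norm h * (3/4) ^ m"
  have P0: "0 \<le> P" by (simp add: P_def)
  have Lz: "norm (L z) \<le> 1/2" using Suc.prems by (simp add: norm_L)
  have w: "norm w \<le> 5/16"
    using norm_approx_L[of z m] Suc.prems unfolding w_def by linarith
  have k: "norm k \<le> norm h * (3/4)"
  proof -
    have "norm k \<le> norm (L h) + norm (k - L h)"
      by (rule norm_triangle_sub)
    also have "\<dots> \<le> norm h / 2 + norm z * norm h / 2"
      using approx_deriv_near_identity[OF Lz, of "Suc m" "L h"] unfolding k_def by (simp add: norm_L)
    also have "\<dots> \<le> norm h * (3/4)"
      using mult_right_mono[OF Suc.prems, of "norm h"] by (simp add: algebra_simps)
    finally show ?thesis .
  qed
  have kl: "norm (k - l) \<le> P / 2"
    using Suc.IH[OF Lz, of "L h"] unfolding k_def l_def P_def by (simp add: norm_L)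
  have vw: "norm (v - w) \<le> norm z * (3/4) ^ m / 8"
  proof -
    have "norm (v - w) \<le> (norm z / 2)\<^sup>2 * (3/4) ^ m"
      using approx_increment[OF Lz, of m] unfolding v_def w_def by (simp add: norm_L)
    also have "\<dots> \<le> (norm z / 8) * (3/4) ^ m"
      using mult_left_mono[OF Suc.prems, of "norm z"]
      by (intro mult_right_mono) (auto simp: power2_eq_square)
    finally show ?thesis by simp
  qed
  have vwk: "norm (v - w) * norm k \<le> P * (3/32)"
  proof -
    have "norm (v - w) * norm k \<le> (norm z * (3/4) ^ m / 8) * (norm h * (3/4))"
      using vw k by (intro mult_mono) auto
    also have "\<dots> = P * (3/32)" by (simp add: P_def)
    finally show ?thesis .
  qed
  have wkl: "norm w * norm (k - l) \<le> 5/16 * (P / 2)"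
    using w kl by (intro mult_mono) auto
  have "approx_deriv (Suc (Suc m)) z h - approx_deriv (Suc m) z h =
      M (k - l) - ((B (v - w) k + B w (k - l)) + (B k (v - w) + B (k - l) w))"
    using linear_diff[OF bounded_linear.linear[OF complex_linear_imp_bounded_linear[OF M]]]
    unfolding approx_deriv.simps(2)[of "Suc m"] approx_deriv.simps(2)[of m z]
      v_def[symmetric] w_def[symmetric] k_def[symmetric] l_def[symmetric]
    by (simp add: bounded_bilinear.diff_left[OF B_bilinear] bounded_bilinear.diff_right[OF B_bilinear])
  also have "norm \<dots> \<le> norm (M (k - l))
      + ((norm (B (v - w) k) + norm (B w (k - l))) + (norm (B k (v - w)) + norm (B (k - l) w)))"
    by (rule order_trans[OF norm_triangle_ineq4 add_left_mono[OF order_trans[OF norm_triangle_ineq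
        add_mono[OF norm_triangle_ineq norm_triangle_ineq]]]])
  also have "\<dots> \<le> 2 * norm (k - l) + ((norm (v - w) * norm k + norm w * norm (k - l))
      + (norm k * norm (v - w) + norm (k - l) * norm w))"
    unfolding norm_M by (intro add_mono norm_B order_refl)
  also have "\<dots> = 2 * norm (k - l) + 2 * (norm (v - w) * norm k) + 2 * (norm w * norm (k - l))"
    by (simp add: mult.commute)
  also have "\<dots> \<le> 3/2 * P"
    using kl vwk wkl P0 by linarith
  also have "\<dots> = 2 * norm z * norm h * (3/4) ^ Suc m"
    by (simp add: P_def)
  finally show ?case .
qed

lemma funpow_L_norm: "norm ((L ^^ k) z) = norm z / 2 ^ k"
  by (induction k) (simp_all add: norm_L)

lemma approx_funpow: "approx (m + k) z = (quad_map ^^ k) (approx m ((L ^^ k) z))"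
proof (induction k arbitrary: z)
  case (Suc k)
  have "approx (m + Suc k) z = quad_map (approx (m + k) (L z))" by simp
  also have "\<dots> = (quad_map ^^ Suc k) (approx m ((L ^^ Suc k) z))"
    by (simp add: Suc funpow_swap1)
  finally show ?case .
qed simp

text \<open>Near \<open>0\<close> the approximations converge together with their derivatives to a map \<open>g\<close>.  Since
  \<open>L ^^ k\<close> moves any point into this neighbourhood, \<open>(quad_map ^^ k) \<circ> g \<circ> (L ^^ k)\<close> extends \<open>g\<close> to
  the whole space; holomorphy and injectivity are inherited from \<open>g\<close> through this formula.\<close>

theorem linearising_map:
  obtains \<Psi> where "holomorphic_map \<Psi>" "inj \<Psi>" "\<Psi> 0 = 0" "\<And>z. \<Psi> z = quad_map (\<Psi> (L z))"
proof -
  let ?U = "ball (0 :: complex ^ 'n) (1/2)"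
  define D' where "D' z h = lim (\<lambda>m. approx_deriv m z h)" for z h
  have D': "(\<lambda>m. approx_deriv m z h) \<longlonglongrightarrow> D' z h"
    "norm (approx_deriv m z h - D' z h) \<le> 4 * norm h * (3/4) ^ m" if "z \<in> ?U" for z h m
  proof -
    have z: "norm z \<le> 1/2" using that by simp
    obtain l where l: "(\<lambda>m. approx_deriv m z h) \<longlonglongrightarrow> l"
      "\<And>m. norm (approx_deriv m z h - l) \<le> 2 * norm z * norm h * (3/4) ^ m / (1 - 3/4)"
      by (rule geometric_increments_converge[of "3/4" "\<lambda>m. approx_deriv m z h" "2 * norm z * norm h"])
         (use approx_deriv_increment[OF z] in auto)
    have eq: "D' z h = l" unfolding D'_def using l(1) by (rule limI)
    show "(\<lambda>m. approx_deriv m z h) \<longlonglongrightarrow> D' z h" using l(1) eq by simp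
    have "norm (approx_deriv m z h - D' z h) \<le> norm z * (8 * norm h * (3/4) ^ m)"
      using l(2)[of m] eq by simp
    also have "\<dots> \<le> 1/2 * (8 * norm h * (3/4) ^ m)"
      using z by (intro mult_right_mono) auto
    finally show "norm (approx_deriv m z h - D' z h) \<le> 4 * norm h * (3/4) ^ m" by simp
  qed
  have D'_linear: "complex_linear (D' z)" if "z \<in> ?U" for z
    unfolding complex_linear_iff
  proof (intro conjI allI)
    fix x y c
    have "(\<lambda>m. approx_deriv m z (x + y)) \<longlonglongrightarrow> D' z x + D' z y"
      using tendsto_add[OF D'(1)[OF that, of x] D'(1)[OF that, of y]] approx_deriv_complex_linear[of _ z]
      by (simp add: complex_linear_iff)
    then show "D' z (x + y) = D' z x + D' z y"
      using D'(1)[OF that] LIMSEQ_unique by blast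
    have "bounded_linear ((*s) c :: complex ^ 'n \<Rightarrow> _)"
      by (intro complex_linear_imp_bounded_linear)
         (simp add: complex_linear_iff vec.scale_right_distrib mult.commute)
    from bounded_linear.tendsto[OF this D'(1)[OF that, of x]]
    have "(\<lambda>m. approx_deriv m z (c *s x)) \<longlonglongrightarrow> c *s D' z x"
      using approx_deriv_complex_linear[of _ z] by (simp add: complex_linear_iff)
    then show "D' z (c *s x) = c *s D' z x"
      using D'(1)[OF that] LIMSEQ_unique by blast
  qed
  have S0: "approx m 0 = 0" for m
    using approx_near_identity[of 0 m] by simp
  have "\<exists>g. \<forall>x\<in>?U. (\<lambda>n. approx n x) \<longlonglongrightarrow> g x \<and> (g has_derivative D' x) (at x within ?U)"
  proof (rule has_derivative_sequence)
    show "convex ?U" by simp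
    show "(approx n has_derivative approx_deriv n x) (at x within ?U)" for n x
      using approx_has_derivative by (rule has_derivative_at_withinI)
    show "0 \<in> ?U" by simp
    show "(\<lambda>n. approx n 0) \<longlonglongrightarrow> 0" by (simp add: S0)
    fix e :: real assume "e > 0"
    have "(\<lambda>m. 4 * (3/4::real) ^ m) \<longlonglongrightarrow> 4 * 0"
      by (intro tendsto_intros LIMSEQ_power_zero) auto
    from order_tendstoD(2)[OF this, of e]
    have "\<forall>\<^sub>F m in sequentially. 4 * (3/4::real) ^ m < e"
      using \<open>e > 0\<close> by simp
    then show "\<forall>\<^sub>F n in sequentially. \<forall>x\<in>?U. \<forall>h. norm (approx_deriv n x h - D' x h) \<le> e * norm h"
    proof eventually_elim
      case (elim n)
      show ?case
      proof (intro ballI allI)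
        fix x h assume "x \<in> ?U"
        have "norm (approx_deriv n x h - D' x h) \<le> (4 * (3/4) ^ n) * norm h"
          using D'(2)[OF \<open>x \<in> ?U\<close>, of n h] by (simp add: mult.commute mult.left_commute)
        also have "\<dots> \<le> e * norm h"
          using elim by (intro mult_right_mono) auto
        finally show "norm (approx_deriv n x h - D' x h) \<le> e * norm h" .
      qed
    qed
  qed
  then obtain g where lim_g:
    "\<forall>x\<in>?U. (\<lambda>n. approx n x) \<longlonglongrightarrow> g x \<and> (g has_derivative D' x) (at x within ?U)" ..
  have g: "(\<lambda>n. approx n x) \<longlonglongrightarrow> g x" if "x \<in> ?U" for x
    using bspec[OF lim_g that] by (rule conjunct1)
  have g': "(g has_derivative D' x) (at x)" if "x \<in> ?U" for x
    using conjunct2[OF bspec[OF lim_g that]] unfolding at_within_open[OF that open_ball] .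

  define \<Psi> where "\<Psi> z = lim (\<lambda>m. approx m z)" for z
  have Ek: "holomorphic_map (quad_map ^^ k)" for k
    by (rule holomorphic_map_funpow[OF holomorphic_map_quad_map])
  \<comment> \<open>Convergence at distant points follows from convergence near \<open>0\<close> by continuity of the iterates.\<close>
  have conv: "(\<lambda>m. approx m z) \<longlonglongrightarrow> (quad_map ^^ k) (g ((L ^^ k) z))" if "(L ^^ k) z \<in> ?U" for k z
  proof -
    have "continuous (at (g ((L ^^ k) z))) (quad_map ^^ k)"
      using holomorphic_map_continuous_on[OF Ek, of UNIV k]
      by (simp add: continuous_on_eq_continuous_at)
    then have "(\<lambda>m. (quad_map ^^ k) (approx m ((L ^^ k) z))) \<longlonglongrightarrow> (quad_map ^^ k) (g ((L ^^ k) z))"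
      using g[OF that] by (rule isCont_tendsto_compose)
    then have "(\<lambda>m. approx (m + k) z) \<longlonglongrightarrow> (quad_map ^^ k) (g ((L ^^ k) z))"
      by (simp add: approx_funpow)
    then show ?thesis by (rule LIMSEQ_offset)
  qed
  have \<Psi>_eq: "\<Psi> z = (quad_map ^^ k) (g ((L ^^ k) z))" if "(L ^^ k) z \<in> ?U" for k z
    unfolding \<Psi>_def using conv[OF that] by (rule limI)
  have small: "\<forall>\<^sub>F k in sequentially. norm ((L ^^ k) z) < e" if "e > 0" for z e
  proof -
    have "(\<lambda>k. norm z * (1/2) ^ k) \<longlonglongrightarrow> norm z * 0"
      by (intro tendsto_intros LIMSEQ_power_zero) auto
    then have "(\<lambda>k. norm ((L ^^ k) z)) \<longlonglongrightarrow> 0"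
      by (simp add: funpow_L_norm power_one_over divide_simps)
    then show ?thesis using that by (rule order_tendstoD(2))
  qed
  have absorb: "\<exists>k. norm ((L ^^ k) z) < e" if "e > 0" for z e
    using eventually_happens'[OF sequentially_bot small[OF that]] .

  have holo: "holomorphic_map \<Psi>"
    unfolding holomorphic_map_def
  proof
    fix z
    obtain k where k: "norm ((L ^^ k) z) < 1/2" using absorb[of "1/2"] by auto
    have hLk: "holomorphic_map (L ^^ k)"
      by (rule holomorphic_map_funpow[OF holomorphic_map_L])
    then obtain L' where L': "((L ^^ k) has_derivative L') (at z)" "complex_linear L'"
      unfolding holomorphic_map_def by blast
    obtain E' where E': "((quad_map ^^ k) has_derivative E') (at (g ((L ^^ k) z)))" "complex_linear E'"
      using Ek unfolding holomorphic_map_def by blast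
    have mem: "(L ^^ k) z \<in> ?U" using k by simp
    have der: "((\<lambda>x. (quad_map ^^ k) (g ((L ^^ k) x))) has_derivative (\<lambda>h. E' (D' ((L ^^ k) z) (L' h)))) (at z)"
      by (rule has_derivative_compose[OF has_derivative_compose[OF L'(1) g'[OF mem]] E'(1)])
    have "open ((L ^^ k) -` ?U)"
      by (intro open_vimage open_ball holomorphic_map_continuous_on hLk)
    from has_derivative_transform_within_open[OF der this]
    have "(\<Psi> has_derivative (\<lambda>h. E' (D' ((L ^^ k) z) (L' h)))) (at z)"
      using mem \<Psi>_eq by auto
    moreover have "complex_linear (\<lambda>h. E' (D' ((L ^^ k) z) (L' h)))"
      by (intro complex_linear_compose[OF _ E'(2)] complex_linear_compose[OF L'(2)] D'_linear mem)
    ultimately show "\<exists>F'. (\<Psi> has_derivative F') (at z) \<and> complex_linear F'" by blast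
  qed

  \<comment> \<open>The radius \<open>1/4\<close> makes \<open>g\<close> minus the identity a contraction with constant \<open>1/2\<close>.\<close>
  have g_inj: "inj_on g (ball 0 (1/4))"
  proof (rule inj_onI)
    fix x y :: "complex ^ 'n"
    assume xy: "x \<in> ball 0 (1/4)" "y \<in> ball 0 (1/4)" and eq: "g x = g y"
    have "norm ((g x - x) - (g y - y)) \<le> 1/2 * norm (x - y)"
    proof (rule differentiable_bound[of "ball 0 (1/4)" _ "\<lambda>z h. D' z h - h"])
      fix z :: "complex ^ 'n" assume z: "z \<in> ball 0 (1/4)"
      then have zU: "z \<in> ?U" by simp
      have "((\<lambda>x. g x - x) has_derivative (\<lambda>h. D' z h - h)) (at z)"
        by (intro has_derivative_diff g' zU has_derivative_ident)
      then show "((\<lambda>x. g x - x) has_derivative (\<lambda>h. D' z h - h)) (at z within ball 0 (1/4))"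
        by (rule has_derivative_at_withinI)
      show "onorm (\<lambda>h. D' z h - h) \<le> 1/2"
      proof (rule onorm_le)
        fix h
        have "(\<lambda>m. norm (approx_deriv m z h - h)) \<longlonglongrightarrow> norm (D' z h - h)"
          by (intro tendsto_intros D'(1)[OF zU])
        moreover have "norm (approx_deriv m z h - h) \<le> 1/2 * norm h" for m
        proof -
          have "norm (approx_deriv m z h - h) \<le> 2 * norm z * norm h"
            using z by (intro approx_deriv_near_identity) auto
          also have "\<dots> \<le> 1/2 * norm h"
            using z by (intro mult_right_mono) auto
          finally show ?thesis .
        qed
        ultimately show "norm (D' z h - h) \<le> 1/2 * norm h"
          by (intro LIMSEQ_le_const2) auto
      qed
    qed (use xy in auto)
    then have "norm (y - x) \<le> 1/2 * norm (y - x)"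
      by (simp add: eq norm_minus_commute)
    then show "x = y" by simp
  qed
  have inj_L: "inj L" by (metis M_L injI)
  have "inj \<Psi>"
  proof (rule injI)
    fix x y assume eq: "\<Psi> x = \<Psi> y"
    have quarter: "(0::real) < 1/4" by simp
    obtain k where k: "norm ((L ^^ k) x) < 1/4" "norm ((L ^^ k) y) < 1/4"
      using eventually_happens'[OF sequentially_bot
          eventually_conj[OF small[OF quarter, of x] small[OF quarter, of y]]] by (elim exE conjE)
    have "(quad_map ^^ k) (g ((L ^^ k) x)) = (quad_map ^^ k) (g ((L ^^ k) y))"
      using eq \<Psi>_eq[of k x] \<Psi>_eq[of k y] k by auto
    moreover have "inj (quad_map ^^ k)"
      using inj_quad_map by (intro inj_fn) (simp add: quad_map_def[abs_def])
    ultimately have "g ((L ^^ k) x) = g ((L ^^ k) y)" by (simp add: inj_eq)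
    then have "(L ^^ k) x = (L ^^ k) y"
      using inj_onD[OF g_inj] k by auto
    then show "x = y" using inj_fn[OF inj_L, of k] by (simp add: inj_eq)
  qed
  moreover have "\<Psi> 0 = 0" unfolding \<Psi>_def by (simp add: S0)
  moreover have "\<Psi> z = quad_map (\<Psi> (L z))" for z
  proof -
    obtain k where "norm ((L ^^ k) (L z)) < 1/2" using absorb[of "1/2" "L z"] by auto
    then have k: "(L ^^ k) (L z) \<in> ?U" by simp
    then have k': "(L ^^ Suc k) z \<in> ?U" by (simp add: funpow_swap1)
    show ?thesis using \<Psi>_eq[OF k] \<Psi>_eq[OF k'] by (simp add: funpow_swap1)
  qed
  ultimately show thesis using that holo by blast
qed

end

section \<open>An entire embedding that avoids a region with one exempt coordinate\<close>

text \<open>Coordinates are enumerated by \<open>h\<close>, and \<open>h 0\<close> is the exempt one: a point belongs to the region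
  when some \<^emph>\<open>other\<close> coordinate is large and dominates the exempt one.  The weight \<open>2 ^ (n - k)\<close> halves
  when a value moves from position \<open>k\<close> to \<open>k + 1\<close>, and so does the value under the inverse of
  the expanding map below; the two effects cancel.  The constant \<open>1 + 2 ^ n\<close> is the size from which
  squaring beats all these factors.\<close>

definition dominated_region :: "nat \<Rightarrow> (nat \<Rightarrow> 'n) \<Rightarrow> (complex ^ 'n) set" where
  "dominated_region n h =
     {x. \<exists>k\<in>{1..<n}. 2 ^ (n - k) * max (1 + 2 ^ n) (norm (x $ h 0)) \<le> norm (x $ h k)}"

lemma norm_permuted_coordinates:
  fixes x :: "complex ^ 'n"
  assumes "bij \<sigma>"
  shows "norm (\<chi> i. c * x $ \<sigma> i) = norm c * norm x"
proof -
  have "L2_set (\<lambda>i. norm (x $ \<sigma> i)) UNIV = L2_set (\<lambda>i. norm (x $ i)) UNIV"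
    using sum.reindex_bij_betw[OF assms, of "\<lambda>i. (norm (x $ i))\<^sup>2"] by (simp add: L2_set_def)
  then show ?thesis
    by (simp add: norm_vec_def norm_mult L2_set_right_distrib[symmetric])
qed

lemma norm_axis: "norm (axis i c :: complex ^ 'n) = norm c"
proof -
  have "(\<Sum>j\<in>UNIV. (norm ((axis i c :: complex ^ 'n) $ j))\<^sup>2)
      = (\<Sum>j\<in>UNIV. if j = i then (norm c)\<^sup>2 else 0)"
    by (rule sum.cong) (auto simp: axis_def)
  then show ?thesis by (simp add: norm_vec_def L2_set_def)
qed

text \<open>The expanding map of this section is a coordinate version of a Henon map: \<open>expand\<close> shifts the
  coordinates cyclically and doubles them, and the square of coordinate \<open>h 0\<close> is subtracted from that
  same coordinate.\<close>

locale cyclic_enumeration =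
  fixes n :: nat and h :: "nat \<Rightarrow> 'n::finite" and p :: "'n \<Rightarrow> nat"
  assumes p_less: "p i < n" and h_p: "h (p i) = i"
    and p_h: "k < n \<Longrightarrow> p (h k) = k" and two_le: "2 \<le> n"
begin

definition next_index :: "'n \<Rightarrow> 'n" where
  "next_index i = (if p i = n - 1 then h 0 else h (Suc (p i)))"

definition prev_index :: "'n \<Rightarrow> 'n" where
  "prev_index i = (if p i = 0 then h (n - 1) else h (p i - 1))"

lemma prev_next: "prev_index (next_index i) = i"
proof (cases "p i = n - 1")
  case True
  then show ?thesis using two_le h_p[of i] by (simp add: prev_index_def next_index_def p_h)
next
  case False
  then have "Suc (p i) < n" using p_less[of i] by linarith
  then show ?thesis using False by (simp add: prev_index_def next_index_def p_h h_p)
qed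

lemma next_prev: "next_index (prev_index i) = i"
proof (cases "p i = 0")
  case True
  then have "h 0 = i" using h_p[of i] by simp
  with True show ?thesis using two_le by (simp add: prev_index_def next_index_def p_h)
next
  case False
  then have "p i - 1 < n" "p i - 1 \<noteq> n - 1" "Suc (p i - 1) = p i"
    using p_less[of i] by linarith+
  then show ?thesis using False by (simp add: prev_index_def next_index_def p_h h_p)
qed

lemma bij_next: "bij next_index" and bij_prev: "bij prev_index"
  by (rule bijI', metis prev_next, metis next_prev)
     (rule bijI', metis next_prev, metis prev_next)

definition contract :: "complex ^ 'n \<Rightarrow> complex ^ 'n" where
  "contract x = (\<chi> i. (1/2) * x $ prev_index i)"

definition expand :: "complex ^ 'n \<Rightarrow> complex ^ 'n" where
  "expand x = (\<chi> i. 2 * x $ next_index i)"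

definition square_term :: "complex ^ 'n \<Rightarrow> complex ^ 'n \<Rightarrow> complex ^ 'n" where
  "square_term x y = axis (h 0) (x $ h 0 * y $ h 0)"

lemma norm_square_term: "norm (square_term x y) \<le> norm x * norm y"
proof -
  have "norm (square_term x y) = norm (x $ h 0) * norm (y $ h 0)"
    by (simp add: square_term_def norm_axis norm_mult)
  also have "\<dots> \<le> norm x * norm y"
    by (intro mult_mono Finite_Cartesian_Product.norm_nth_le) auto
  finally show ?thesis .
qed

sublocale quadratic_expansion contract expand square_term
proof (rule quadratic_expansion.intro)
  show "complex_linear contract" "complex_linear expand"
    by (simp_all add: complex_linear_iff contract_def expand_def vec_eq_iff algebra_simps)
  show "norm (contract x) = norm x / 2" for x
    using norm_permuted_coordinates[OF bij_prev, of "1/2" x] by (simp add: contract_def)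
  show "norm (expand x) = 2 * norm x" for x
    using norm_permuted_coordinates[OF bij_next, of 2 x] by (simp add: expand_def)
  show "expand (contract x) = x" for x
    by (simp add: expand_def contract_def vec_eq_iff prev_next)
  show "complex_linear (\<lambda>x. square_term x y)" "complex_linear (square_term y)" for y
    by (simp_all add: complex_linear_iff square_term_def vec_eq_iff axis_def algebra_simps)
  show "bounded_bilinear square_term"
  proof
    show "\<exists>K. \<forall>x y. norm (square_term x y) \<le> norm x * norm y * K"
      using norm_square_term by (intro exI[of _ 1]) simp
  qed (simp_all add: square_term_def vec_eq_iff axis_def algebra_simps)
  show "norm (square_term x y) \<le> norm x * norm y" for x y
    by (rule norm_square_term)
  show "inj (\<lambda>x. expand x - square_term x x)"
  proof (rule injI)
    fix x y assume eq: "expand x - square_term x x = expand y - square_term y y"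
    have coord: "expand x $ i - square_term x x $ i = expand y $ i - square_term y y $ i" for i
      using arg_cong[OF eq, of "\<lambda>v. v $ i"] by simp
    have "h (n - 1) \<noteq> h 0"
      using p_h[of "n - 1"] p_h[of 0] two_le by auto
    moreover have "next_index (h (n - 1)) = h 0"
      using two_le by (simp add: next_index_def p_h)
    ultimately have 0: "x $ h 0 = y $ h 0"
      using coord[of "h (n - 1)"] by (simp add: expand_def square_term_def axis_def)
    have "x $ i = y $ i" for i
      using coord[of "prev_index i"] 0 by (simp add: expand_def square_term_def next_prev)
    then show "x = y" by (simp add: vec_eq_iff)
  qed
qed

lemma quad_map_coords:
  shows "quad_map y $ h 0 = 2 * y $ h 1 - (y $ h 0)\<^sup>2"
    and "\<And>k. 1 \<le> k \<Longrightarrow> Suc k < n \<Longrightarrow> quad_map y $ h k = 2 * y $ h (Suc k)"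
    and "quad_map y $ h (n - 1) = 2 * y $ h 0"
proof -
  have ne: "h k \<noteq> h 0" if "1 \<le> k" "k < n" for k
    using that p_h[of k] p_h[of 0] by auto
  show "quad_map y $ h 0 = 2 * y $ h 1 - (y $ h 0)\<^sup>2"
    using two_le by (simp add: quad_map_def expand_def square_term_def next_index_def p_h axis_def power2_eq_square)
  show "quad_map y $ h k = 2 * y $ h (Suc k)" if "1 \<le> k" "Suc k < n" for k
    using that ne[of k] by (auto simp: quad_map_def expand_def square_term_def next_index_def p_h axis_def)
  show "quad_map y $ h (n - 1) = 2 * y $ h 0"
    using two_le ne[of "n - 1"] by (simp add: quad_map_def expand_def square_term_def next_index_def p_h axis_def)
qed

text \<open>Let position \<open>k\<close> carry the largest weighted value \<open>w k\<close> of the image point.  If \<open>k\<close> is not the last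
  position, then coordinate \<open>k + 1\<close> of \<open>y\<close> has the same weighted value and still dominates.  If
  \<open>k\<close> is the last position, then that value sits at the exempt coordinate of \<open>y\<close>, but its square can
  only have been compensated in the image by coordinate \<open>1\<close> of \<open>y\<close>, which is therefore even larger.\<close>

lemma dominated_region_backward:
  assumes "quad_map y \<in> dominated_region n h"
  shows "y \<in> dominated_region n h"
proof -
  define w where "w k = norm (quad_map y $ h k) / 2 ^ (n - k)" for k
  define R :: real where "R = 1 + 2 ^ n"
  have weight: "2 ^ j * r \<le> norm v \<longleftrightarrow> r \<le> norm v / 2 ^ j" for v :: complex and j and r :: real
    by (simp add: field_simps)
  have fin: "finite (w ` {1..<n})" "w ` {1..<n} \<noteq> {}"
    using two_le by auto
  obtain k where k: "k \<in> {1..<n}" "Max (w ` {1..<n}) = w k"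
    using Max_in[OF fin] by auto
  have max: "w j \<le> w k" if "j \<in> {1..<n}" for j
    using Max_ge[OF fin(1) imageI[OF that]] unfolding k(2) .
  obtain j where "j \<in> {1..<n}" "max R (norm (quad_map y $ h 0)) \<le> w j"
    using assms unfolding dominated_region_def w_def R_def weight by blast
  then have large: "w k \<ge> R" "w k \<ge> norm (quad_map y $ h 0)"
    using max[of j] by auto
  have y0: "norm (y $ h 0) = w (n - 1)"
    using two_le by (simp add: w_def quad_map_coords(3)[simplified] norm_mult)
  show ?thesis
  proof (cases "k = n - 1")
    case True
    \<comment> \<open>Here \<open>norm (y $ h 0) = w k\<close>, and \<open>2 * y $ h 1\<close> is the sum of \<open>(y $ h 0)\<^sup>2\<close> and a term bounded by \<open>w k\<close>.\<close>
    have "2 * norm (y $ h 1) = norm (2 * y $ h 1)"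
      by (simp add: norm_mult)
    also have "2 * y $ h 1 = (y $ h 0)\<^sup>2 - (- (quad_map y $ h 0))"
      by (simp add: quad_map_coords(1))
    finally have "2 * norm (y $ h 1) = norm ((y $ h 0)\<^sup>2 - (- (quad_map y $ h 0)))" .
    moreover have "norm ((y $ h 0)\<^sup>2) - norm (- (quad_map y $ h 0)) \<le> norm ((y $ h 0)\<^sup>2 - (- (quad_map y $ h 0)))"
      by (rule norm_triangle_ineq2)
    ultimately have "(w k)\<^sup>2 - w k \<le> 2 * norm (y $ h 1)"
      using large(2) y0 True by (simp add: norm_power)
    then have "w k * (w k - 1) \<le> 2 * norm (y $ h 1)"
      by (simp add: power2_eq_square algebra_simps)
    moreover have "w k * 2 ^ n \<le> w k * (w k - 1)"
      using large(1) by (intro mult_left_mono) (auto simp: R_def intro: order_trans[of 0 "1 + 2 ^ n"])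
    moreover have "(2::real) ^ n = 2 * 2 ^ (n - 1)"
      using two_le by (simp flip: power_Suc)
    ultimately have "2 ^ (n - 1) * w k \<le> norm (y $ h 1)"
      by (simp add: algebra_simps)
    moreover have "max R (norm (y $ h 0)) \<le> w k"
      using large(1) y0 True by simp
    ultimately have "2 ^ (n - 1) * max R (norm (y $ h 0)) \<le> norm (y $ h 1)"
      by (meson order_trans mult_left_mono zero_le_power zero_le_numeral)
    then show ?thesis
      unfolding dominated_region_def R_def using two_le by (auto intro!: bexI[of _ 1])
  next
    case False
    then have k': "1 \<le> k" "Suc k < n" using k(1) by auto
    have "w k = norm (y $ h (Suc k)) / 2 ^ (n - Suc k)"
    proof -
      have "n - k = Suc (n - Suc k)" using k' by simp
      then show ?thesis by (simp add: w_def quad_map_coords(2)[OF k'] norm_mult)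
    qed
    moreover have "max R (norm (y $ h 0)) \<le> w k"
      using large(1) y0 max[of "n - 1"] two_le by simp
    ultimately have "norm (y $ h (Suc k)) \<ge> 2 ^ (n - Suc k) * max R (norm (y $ h 0))"
      by (simp add: weight)
    then show ?thesis
      unfolding dominated_region_def R_def using k' by (auto intro!: bexI[of _ "Suc k"])
  qed
qed

lemma dominated_region_norm:
  assumes "x \<in> dominated_region n h"
  shows "1 \<le> norm x"
proof -
  obtain k where k: "2 ^ (n - k) * max (1 + 2 ^ n) (norm (x $ h 0)) \<le> norm (x $ h k)"
    using assms unfolding dominated_region_def by blast
  have "1 * 1 \<le> 2 ^ (n - k) * max (1 + 2 ^ n) (norm (x $ h 0))"
    by (intro mult_mono) (auto simp: le_max_iff_disj)
  then show ?thesis using k Finite_Cartesian_Product.norm_nth_le[of x "h k"] by linarith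
qed

lemma dominated_region_nonempty: "dominated_region n h \<noteq> {}"
proof -
  have "h 1 \<noteq> h 0"
    using p_h[of 1] p_h[of 0] two_le by auto
  moreover define r :: real where "r = 1 + 2 ^ n"
  moreover have "0 < r"
    unfolding r_def by (rule add_pos_pos) simp_all
  ultimately have "axis (h 1) (complex_of_real (2 ^ (n - 1) * r)) \<in> dominated_region n h"
    unfolding dominated_region_def mem_Collect_eq r_def[symmetric]
    using two_le by (intro bexI[of _ 1]) (simp_all add: axis_def norm_mult norm_power)
  then show ?thesis by blast
qed

text \<open>If \<open>\<Psi> z\<close> were in the region, backward invariance and the conjugacy equation would put all the points
  \<open>\<Psi> ((contract ^^ k) z)\<close> there as well.  But these converge to \<open>\<Psi> 0 = 0\<close>, whereas the region
  stays away from \<open>0\<close>.\<close>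

theorem entire_embedding_avoiding_dominated_region:
  obtains \<Psi> :: "complex ^ 'n \<Rightarrow> complex ^ 'n"
  where "holomorphic_map \<Psi>" "inj \<Psi>" "range \<Psi> \<inter> dominated_region n h = {}"
proof -
  obtain \<Psi> where \<Psi>: "holomorphic_map \<Psi>" "inj \<Psi>" "\<Psi> 0 = 0" "\<And>z. \<Psi> z = quad_map (\<Psi> (contract z))"
    by (rule linearising_map) blast
  have "\<Psi> z \<notin> dominated_region n h" for z
  proof
    assume z: "\<Psi> z \<in> dominated_region n h"
    have "\<Psi> ((contract ^^ k) z) \<in> dominated_region n h" for k
    proof (induction k)
      case (Suc k)
      then show ?case
        using dominated_region_backward \<Psi>(4)[of "(contract ^^ k) z"] by simp
    qed (simp add: z)
    then have large: "1 \<le> norm (\<Psi> ((contract ^^ k) z))" for k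
      by (rule dominated_region_norm)
    have "(\<lambda>k. norm z * (1/2) ^ k) \<longlonglongrightarrow> norm z * 0"
      by (intro tendsto_intros LIMSEQ_power_zero) auto
    then have "(\<lambda>k. norm ((contract ^^ k) z)) \<longlonglongrightarrow> 0"
      by (simp add: funpow_L_norm power_one_over divide_simps)
    then have "(\<lambda>k. (contract ^^ k) z) \<longlonglongrightarrow> 0"
      by (rule tendsto_norm_zero_cancel)
    moreover have "isCont \<Psi> 0"
      using holomorphic_map_continuous_on[OF \<Psi>(1), of UNIV] by (simp add: continuous_on_eq_continuous_at)
    ultimately have "(\<lambda>k. \<Psi> ((contract ^^ k) z)) \<longlonglongrightarrow> \<Psi> 0"
      by (intro isCont_tendsto_compose[of _ \<Psi>])
    then have "(\<lambda>k. norm (\<Psi> ((contract ^^ k) z))) \<longlonglongrightarrow> 0"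
      using \<Psi>(3) tendsto_norm_zero by fastforce
    then have "1 \<le> (0::real)"
      by (rule LIMSEQ_le_const) (use large in auto)
    then show False by simp
  qed
  then show thesis using that \<Psi> by blast
qed

end

section \<open>An entire function that is large on a sequence of annuli\<close>

text \<open>A single monomial \<open>(\<zeta> / \<rho>) ^ N\<close> of high degree, with \<open>\<rho>\<close> between \<open>r\<close> and \<open>s\<close>, is negligible on the
  disc of radius \<open>r\<close> and overwhelms \<open>\<phi>\<close>, which is bounded on the disc of radius \<open>t\<close>,
  in the annulus between \<open>s\<close> and \<open>t\<close>.\<close>

lemma entire_correction:
  fixes \<phi> :: "complex \<Rightarrow> complex"
  assumes \<phi>: "\<phi> holomorphic_on UNIV" and r: "0 < r" "r < s" and \<epsilon>: "0 < \<epsilon>"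
  obtains \<psi> where "\<psi> holomorphic_on UNIV"
    "\<And>\<zeta>. norm \<zeta> \<le> r \<Longrightarrow> norm (\<psi> \<zeta> - \<phi> \<zeta>) \<le> \<epsilon>"
    "\<And>\<zeta>. s \<le> norm \<zeta> \<Longrightarrow> norm \<zeta> \<le> t \<Longrightarrow> C \<le> norm (\<psi> \<zeta>)"
proof -
  define \<rho> where "\<rho> = (r + s) / 2"
  have \<rho>: "0 < \<rho>" "r < \<rho>" "\<rho> < s" using r by (auto simp: \<rho>_def)
  have "bounded (\<phi> ` cball 0 t)"
    by (intro compact_imp_bounded compact_continuous_image holomorphic_on_imp_continuous_on
        holomorphic_on_subset[OF \<phi>]) auto
  then obtain A where "\<forall>x\<in>\<phi> ` cball 0 t. norm x \<le> A"
    unfolding bounded_iff ..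
  then have A: "norm (\<phi> \<zeta>) \<le> A" if "norm \<zeta> \<le> t" for \<zeta>
    using that by simp
  have "(\<lambda>N. (r / \<rho>) ^ N) \<longlonglongrightarrow> 0"
    using r \<rho> by (intro LIMSEQ_power_zero) auto
  then have "\<forall>\<^sub>F N in sequentially. (r / \<rho>) ^ N < \<epsilon>"
    using \<epsilon> by (rule order_tendstoD(2))
  moreover have "\<forall>\<^sub>F N in sequentially. C + A < (s / \<rho>) ^ N"
  proof -
    have gt1: "1 < s / \<rho>" using \<rho> by simp
    obtain N\<^sub>0 where N0: "C + A < (s / \<rho>) ^ N\<^sub>0"
      using real_arch_pow[OF gt1] by blast
    have "C + A < (s / \<rho>) ^ N" if "N\<^sub>0 \<le> N" for N
      using N0 power_increasing[OF that, of "s / \<rho>"] gt1 by linarith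
    then show ?thesis
      unfolding eventually_sequentially by blast
  qed
  ultimately have "\<forall>\<^sub>F N in sequentially. (r / \<rho>) ^ N < \<epsilon> \<and> C + A < (s / \<rho>) ^ N"
    by (rule eventually_conj)
  then obtain N where N: "(r / \<rho>) ^ N < \<epsilon>" "C + A < (s / \<rho>) ^ N"
    using eventually_happens'[OF sequentially_bot] by blast
  define \<psi> where "\<psi> \<zeta> = \<phi> \<zeta> + (\<zeta> / of_real \<rho>) ^ N" for \<zeta>
  have norm_term: "norm ((\<zeta> / of_real \<rho>) ^ N) = (norm \<zeta> / \<rho>) ^ N" for \<zeta> :: complex
    using \<rho> by (simp add: norm_power norm_divide)
  show thesis
  proof
    show "\<psi> holomorphic_on UNIV"
      unfolding \<psi>_def[abs_def] using \<rho> by (intro holomorphic_intros \<phi>) auto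
    show "norm (\<psi> \<zeta> - \<phi> \<zeta>) \<le> \<epsilon>" if "norm \<zeta> \<le> r" for \<zeta>
    proof -
      have "norm (\<psi> \<zeta> - \<phi> \<zeta>) = (norm \<zeta> / \<rho>) ^ N"
        by (simp add: \<psi>_def norm_term)
      also have "\<dots> \<le> (r / \<rho>) ^ N"
        using that \<rho> by (intro power_mono divide_right_mono) auto
      finally show ?thesis using N(1) by simp
    qed
    show "C \<le> norm (\<psi> \<zeta>)" if "s \<le> norm \<zeta>" "norm \<zeta> \<le> t" for \<zeta>
    proof -
      have "(s / \<rho>) ^ N \<le> (norm \<zeta> / \<rho>) ^ N"
        using that r \<rho> by (intro power_mono divide_right_mono) auto
      also have "\<dots> - norm (\<phi> \<zeta>) \<le> norm (\<psi> \<zeta>)"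
        using norm_triangle_ineq2[of "(\<zeta> / of_real \<rho>) ^ N" "- \<phi> \<zeta>"]
        by (simp add: \<psi>_def norm_term add.commute)
      finally show ?thesis using N(2) A[OF that(2)] by linarith
    qed
  qed
qed

text \<open>Starting from a constant, each further annulus is treated by one correction; the gap before the annulus
  is where the correcting monomial grows from tiny to huge.  The \<open>k\<close>-th correction disturbs the
  disc of radius \<open>b k\<close>, which contains all earlier annuli, by at most \<open>(1/2) ^ k\<close>;
  all later corrections together amount to at most \<open>2\<close>, which is the margin kept in \<open>P\<close>.\<close>

lemma entire_function_large_on_annuli:
  fixes a b C :: "nat \<Rightarrow> real"
  assumes pos: "\<And>k. 0 < b k" and ab: "\<And>k. a k < b k" and ba: "\<And>k. b k < a (Suc k)"
    and b_lim: "filterlim b at_top sequentially"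
  obtains f where "f holomorphic_on UNIV"
    "\<And>k \<zeta>. a k \<le> norm \<zeta> \<Longrightarrow> norm \<zeta> \<le> b k \<Longrightarrow> C k \<le> norm (f \<zeta> :: complex)"
proof -
  define P where "P k \<phi> \<longleftrightarrow> \<phi> holomorphic_on UNIV \<and>
    (\<forall>\<zeta>. a k \<le> norm \<zeta> \<longrightarrow> norm \<zeta> \<le> b k \<longrightarrow> C k + 2 \<le> norm (\<phi> \<zeta>))" for k and \<phi> :: "complex \<Rightarrow> complex"
  define Q where "Q k \<phi> \<psi> \<longleftrightarrow> (\<forall>\<zeta>. norm \<zeta> \<le> b k \<longrightarrow> norm (\<psi> \<zeta> - \<phi> \<zeta>) \<le> (1/2) ^ k)"
    for k and \<phi> \<psi> :: "complex \<Rightarrow> complex"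
  have "\<exists>\<phi>. \<forall>k. P k (\<phi> k) \<and> Q k (\<phi> k) (\<phi> (Suc k))"
  proof (rule dependent_nat_choice)
    show "\<exists>\<phi>. P 0 \<phi>"
      by (rule exI[of _ "\<lambda>_. of_real (\<bar>C 0\<bar> + 2)"]) (auto simp: P_def simp del: of_real_add)
    fix \<phi> k assume "P k \<phi>"
    then have \<phi>: "\<phi> holomorphic_on UNIV" by (simp add: P_def)
    obtain \<psi> where "\<psi> holomorphic_on UNIV"
      "\<And>\<zeta>. norm \<zeta> \<le> b k \<Longrightarrow> norm (\<psi> \<zeta> - \<phi> \<zeta>) \<le> (1/2) ^ k"
      "\<And>\<zeta>. a (Suc k) \<le> norm \<zeta> \<Longrightarrow> norm \<zeta> \<le> b (Suc k) \<Longrightarrow> C (Suc k) + 2 \<le> norm (\<psi> \<zeta>)"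
      by (rule entire_correction[OF \<phi> pos[of k] ba[of k], of "(1/2) ^ k" "b (Suc k)" "C (Suc k) + 2"]) auto
    then show "\<exists>\<psi>. P (Suc k) \<psi> \<and> Q k \<phi> \<psi>"
      unfolding P_def Q_def by blast
  qed
  then obtain \<phi> where "\<forall>k. P k (\<phi> k) \<and> Q k (\<phi> k) (\<phi> (Suc k))" ..
  then have holo: "\<phi> k holomorphic_on UNIV"
    and large: "\<And>\<zeta>. a k \<le> norm \<zeta> \<Longrightarrow> norm \<zeta> \<le> b k \<Longrightarrow> C k + 2 \<le> norm (\<phi> k \<zeta>)"
    and step: "\<And>\<zeta>. norm \<zeta> \<le> b k \<Longrightarrow> norm (\<phi> (Suc k) \<zeta> - \<phi> k \<zeta>) \<le> (1/2) ^ k" for k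
    unfolding P_def Q_def by auto
  have mono: "b K \<le> b (K + m)" for K m
  proof (induction m)
    case (Suc m)
    then show ?case using ab[of "Suc (K + m)"] ba[of "K + m"] by simp
  qed simp
  define f where "f \<zeta> = lim (\<lambda>k. \<phi> k \<zeta>)" for \<zeta>
  have close: "norm (\<phi> (K + m) \<zeta> - f \<zeta>) \<le> 2 * (1/2) ^ (K + m)" if "norm \<zeta> \<le> b K" for K m \<zeta>
  proof -
    have increment: "norm (\<phi> (K + Suc m) \<zeta> - \<phi> (K + m) \<zeta>) \<le> (1/2) ^ K * (1/2) ^ m" for m
      using step[of \<zeta> "K + m"] that mono[of K m] by (simp add: power_add)
    obtain l where l: "(\<lambda>m. \<phi> (K + m) \<zeta>) \<longlonglongrightarrow> l"
      "\<And>m. norm (\<phi> (K + m) \<zeta> - l) \<le> (1/2) ^ K * (1/2) ^ m / (1 - 1/2)"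
      by (rule geometric_increments_converge[of "1/2" "\<lambda>m. \<phi> (K + m) \<zeta>", OF _ _ increment]) auto
    have "(\<lambda>m. \<phi> m \<zeta>) \<longlonglongrightarrow> l"
      by (rule LIMSEQ_offset[where k = K]) (use l(1) in \<open>simp add: add.commute\<close>)
    then have "f \<zeta> = l" unfolding f_def by (rule limI)
    then show ?thesis using l(2)[of m] by (simp add: power_add)
  qed
  show thesis
  proof
    show "f holomorphic_on UNIV"
    proof (rule holomorphic_uniform_sequence[of UNIV \<phi>])
      fix x :: complex
      have "\<forall>\<^sub>F K in sequentially. norm x + 1 \<le> b K"
        using b_lim by (simp add: filterlim_at_top)
      then obtain K where K: "norm x + 1 \<le> b K"
        using eventually_happens'[OF sequentially_bot] by blast
      have "uniform_limit (cball x 1) \<phi> f sequentially"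
      proof (rule uniform_limitI)
        fix e :: real assume "0 < e"
        have "(\<lambda>k. 2 * (1/2::real) ^ k) \<longlonglongrightarrow> 2 * 0"
          by (intro tendsto_intros LIMSEQ_power_zero) auto
        from order_tendstoD(2)[OF this, of e]
        have "\<forall>\<^sub>F k in sequentially. 2 * (1/2::real) ^ k < e"
          using \<open>0 < e\<close> by simp
        moreover have "\<forall>\<^sub>F k in sequentially. K \<le> k"
          by (rule eventually_ge_at_top)
        ultimately show "\<forall>\<^sub>F k in sequentially. \<forall>\<zeta>\<in>cball x 1. dist (\<phi> k \<zeta>) (f \<zeta>) < e"
        proof eventually_elim
          case (elim k)
          show ?case
          proof
            fix \<zeta> assume "\<zeta> \<in> cball x 1"
            then have "norm \<zeta> \<le> b K"
              using K norm_triangle_sub[of \<zeta> x] by (simp add: dist_norm norm_minus_commute)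
            from close[OF this, of "k - K"] elim show "dist (\<phi> k \<zeta>) (f \<zeta>) < e"
              by (simp add: dist_norm)
          qed
        qed
      qed
      then show "\<exists>d>0. cball x d \<subseteq> UNIV \<and> uniform_limit (cball x d) \<phi> f sequentially"
        by (intro exI[of _ 1]) auto
    qed (use holo in auto)
    show "C k \<le> norm (f \<zeta>)" if "a k \<le> norm \<zeta>" "norm \<zeta> \<le> b k" for k \<zeta>
    proof -
      have "norm (\<phi> k \<zeta> - f \<zeta>) \<le> 2 * (1/2) ^ k"
        using close[OF that(2), of 0] by simp
      also have "\<dots> \<le> 2 * 1"
        by (intro mult_left_mono power_le_one) auto
      finally show ?thesis
        using large[OF that] norm_triangle_sub[of "\<phi> k \<zeta>" "f \<zeta>"] by linarith
    qed
  qed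
qed

section \<open>Moving the shells\<close>

lemma has_derivative_vec_lambda:
  fixes f :: "'i::finite \<Rightarrow> complex ^ 'n \<Rightarrow> complex"
  assumes "\<And>i. (f i has_derivative f' i) (at z)"
  shows "((\<lambda>x. \<chi> i. f i x) has_derivative (\<lambda>h. \<chi> i. f' i h)) (at z)"
proof (rule has_derivative_componentwise_within[THEN iffD2], rule ballI)
  fix e :: "complex ^ 'i" assume "e \<in> Basis"
  then obtain i u where e: "e = axis i u" by (auto simp: Basis_vec_def)
  have "((\<lambda>x. f i x \<bullet> u) has_derivative (\<lambda>h. f' i h \<bullet> u)) (at z)"
    by (rule has_derivative_inner_left[OF assms])
  then show "((\<lambda>x. (\<chi> i. f i x) \<bullet> e) has_derivative (\<lambda>h. (\<chi> i. f' i h) \<bullet> e)) (at z)"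
    by (simp add: e inner_axis)
qed

context cyclic_enumeration
begin

text \<open>Coordinate \<open>h k\<close> of the inverse of the triangular automorphism that adds \<open>f\<close> of each coordinate to
  the next one.\<close>

primrec unshear :: "(complex \<Rightarrow> complex) \<Rightarrow> nat \<Rightarrow> complex ^ 'n \<Rightarrow> complex" where
  "unshear f 0 x = x $ h 0"
| "unshear f (Suc k) x = x $ h (Suc k) - f (unshear f k x)"

text \<open>The two coordinate identities describe the triangular map itself as a left inverse of \<open>\<Theta>\<close>;
  solving them for the coordinates of \<open>\<Theta> x\<close> one after the other gives \<open>unshear\<close>.\<close>

lemma triangular_automorphism:
  assumes f: "f holomorphic_on UNIV"
  obtains \<Theta> :: "complex ^ 'n \<Rightarrow> complex ^ 'n" where "holomorphic_map \<Theta>" "inj \<Theta>"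
    "\<And>x. x $ h 0 = \<Theta> x $ h 0"
    "\<And>x k. Suc k < n \<Longrightarrow> x $ h (Suc k) = \<Theta> x $ h (Suc k) + f (\<Theta> x $ h k)"
proof -
  define \<Theta> where "\<Theta> x = (\<chi> i. unshear f (p i) x)" for x
  have \<Theta>_h: "\<Theta> x $ h k = unshear f k x" if "k < n" for k x
    using that by (simp add: \<Theta>_def p_h)
  have first: "x $ h 0 = \<Theta> x $ h 0" for x
    using two_le by (simp add: \<Theta>_h)
  have later: "x $ h (Suc k) = \<Theta> x $ h (Suc k) + f (\<Theta> x $ h k)" if "Suc k < n" for x k
    using that by (simp add: \<Theta>_h)
  have "inj \<Theta>"
  proof (rule injI)
    fix x y assume eq: "\<Theta> x = \<Theta> y"
    have "x $ h k = y $ h k" if "k < n" for k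
      using that first[of x] first[of y] later[of "k - 1" x] later[of "k - 1" y] eq
      by (cases k) auto
    then have "x $ i = y $ i" for i
      using p_less[of i] h_p[of i] by metis
    then show "x = y" by (simp add: vec_eq_iff)
  qed
  moreover have "holomorphic_map \<Theta>"
    unfolding holomorphic_map_def
  proof
    fix z
    have "\<exists>D. (unshear f k has_derivative D) (at z) \<and>
        (\<forall>x y. D (x + y) = D x + D y) \<and> (\<forall>c x. D (c *s x) = c * D x)" for k
    proof (induction k)
      case 0
      have "unshear f 0 = (\<lambda>x. x $ h 0)" by (simp add: fun_eq_iff)
      then show ?case
        using bounded_linear_imp_has_derivative[OF bounded_linear_vec_nth[of "h 0"]]
        by (intro exI[of _ "\<lambda>v. v $ h 0"]) simp
    next
      case (Suc k)
      then obtain D where D: "(unshear f k has_derivative D) (at z)"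
        "\<And>x y. D (x + y) = D x + D y" "\<And>c x. D (c *s x) = c * D x"
        by blast
      obtain d where d: "(f has_field_derivative d) (at (unshear f k z))"
        using f by (auto simp: holomorphic_on_open)
      have "((\<lambda>x. f (unshear f k x)) has_derivative (\<lambda>v. d * D v)) (at z)"
        using has_derivative_compose[OF D(1) d[unfolded has_field_derivative_def]] by simp
      then have "((\<lambda>x. x $ h (Suc k) - f (unshear f k x)) has_derivative (\<lambda>v. v $ h (Suc k) - d * D v)) (at z)"
        by (intro has_derivative_diff bounded_linear_imp_has_derivative[OF bounded_linear_vec_nth])
      moreover have "unshear f (Suc k) = (\<lambda>x. x $ h (Suc k) - f (unshear f k x))"
        by (simp add: fun_eq_iff)
      ultimately show ?case
        using D(2,3) by (intro exI[of _ "\<lambda>v. v $ h (Suc k) - d * D v"]) (auto simp: algebra_simps)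
    qed
    then obtain D where D: "\<And>k. (unshear f k has_derivative D k) (at z)"
        "\<And>k x y. D k (x + y) = D k x + D k y" "\<And>k c x. D k (c *s x) = c * D k x"
      by metis
    have "(\<Theta> has_derivative (\<lambda>v. \<chi> i. D (p i) v)) (at z)"
      unfolding \<Theta>_def[abs_def] by (rule has_derivative_vec_lambda) (rule D(1))
    moreover have "complex_linear (\<lambda>v. \<chi> i. D (p i) v)"
      by (simp add: complex_linear_iff vec_eq_iff D)
    ultimately show "\<exists>F'. (\<Theta> has_derivative F') (at z) \<and> complex_linear F'" by blast
  qed
  ultimately show thesis using that first later by blast
qed

end

lemma shell_times_disc_bounds:
  fixes z :: "complex ^ ('m::finite option)"
  assumes "z \<in> times_last ((*\<^sub>R) b ` closed_polydisk - (*\<^sub>R) a ` open_polydisk) ((*\<^sub>R) c ` cball 0 1)"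
    and "0 < a" "a < b" "0 < c"
  shows "\<And>j. norm (z $ Some j) \<le> b" and "norm (z $ None) \<le> c" and "\<exists>j. a \<le> norm (z $ Some j)"
proof -
  define v where "v = (\<chi> j. z $ Some j)"
  have v: "v \<in> (*\<^sub>R) b ` closed_polydisk" "v \<notin> (*\<^sub>R) a ` open_polydisk"
    and last: "z $ None \<in> (*\<^sub>R) c ` cball 0 1"
    using assms(1) unfolding times_last_def v_def by auto
  show "norm (z $ Some j) \<le> b" for j
  proof -
    obtain w where "v = b *\<^sub>R w" "w \<in> closed_polydisk" using v(1) by blast
    then have "norm (v $ j) \<le> b * 1"
      using assms(2,3) unfolding closed_polydisk_def by (auto intro: mult_left_mono)
    then show ?thesis by (simp add: v_def)
  qed
  show "norm (z $ None) \<le> c"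
    using last assms(4) by (auto intro: mult_left_le)
  show "\<exists>j. a \<le> norm (z $ Some j)"
  proof (rule ccontr)
    assume "\<not> ?thesis"
    then have "norm (v $ j) < a" for j by (simp add: v_def not_le)
    then have "(1 / a) *\<^sub>R v \<in> open_polydisk"
      using assms(2) by (simp add: open_polydisk_def)
    moreover have "v = a *\<^sub>R ((1 / a) *\<^sub>R v)" using assms(2) by simp
    ultimately show False using v(2) by blast
  qed
qed

theorem theorem3p1:
  fixes a b c :: "nat \<Rightarrow> real"
    and K :: "(complex ^ ('m::finite option)) set"
  assumes "0 < a 1"
    and "\<And>i. 1 \<le> i \<Longrightarrow> a i < b i"
    and "\<And>i. 1 \<le> i \<Longrightarrow> b i < a (Suc i)"
    and "\<And>i. 1 \<le> i \<Longrightarrow> 0 < c i"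
    and "filterlim a at_top sequentially"
    and "filterlim b at_top sequentially"
    and "K = (\<Union>i\<in>{1..}. times_last
               ((*\<^sub>R) (b i) ` closed_polydisk - (*\<^sub>R) (a i) ` open_polydisk)
               ((*\<^sub>R) (c i) ` cball 0 1))"
  shows "\<exists>\<Omega>. fatou_bieberbach_domain \<Omega> \<and> \<Omega> \<subseteq> UNIV - K"
proof -
  define N where "N = CARD('m)"
  define n where "n = Suc N"
  obtain e :: "'m \<Rightarrow> nat" where e: "bij_betw e UNIV {0..<N}"
    using ex_bij_betw_finite_nat[of "UNIV :: 'm set"] by (auto simp: N_def)
  \<comment> \<open>The last coordinate gets the last position: then it is not the exempt one, and every other
    coordinate has a successor that receives its value under \<open>f\<close>.\<close>
  define p where "p i = (case i of None \<Rightarrow> N | Some j \<Rightarrow> e j)" for i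
  have e_less: "e j < N" for j
    using bij_betw_apply[OF e, of j] by simp
  have p_None: "p None = N" and p_Some: "p (Some j) < N" for j
    by (simp_all add: p_def e_less)
  have inj_p: "inj p"
  proof (rule injI)
    fix i j assume eq: "p i = p j"
    show "i = j"
    proof (cases i; cases j)
      fix i' j' assume ij: "i = Some i'" "j = Some j'"
      then have "e i' = e j'" using eq by (simp add: p_def)
      then show ?thesis using ij bij_betw_imp_inj_on[OF e] by (simp add: inj_eq)
    qed (use eq e_less in \<open>auto simp: p_def dest: less_imp_neq\<close>)
  qed
  have range_p: "k \<in> range p" if "k < n" for k
  proof (cases "k = N")
    case True
    then show ?thesis using p_None by (metis rangeI)
  next
    case False
    then have "k \<in> e ` UNIV"
      using that bij_betw_imp_surj_on[OF e] by (simp add: n_def)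
    then obtain j where "k = e j" by blast
    then have "k = p (Some j)" by (simp add: p_def)
    then show ?thesis by blast
  qed
  define h where "h = inv p"
  interpret cyclic_enumeration n h p
  proof
    show "p i < n" for i
      using p_None p_Some by (cases i) (auto simp: n_def less_Suc_eq)
    show "h (p i) = i" for i
      by (simp add: h_def inj_p)
    show "p (h k) = k" if "k < n" for k
      using range_p[OF that] by (simp add: h_def f_inv_into_f)
    show "2 \<le> n" by (simp add: n_def N_def Suc_le_eq)
  qed

  have a_pos: "0 < a i" if "1 \<le> i" for i
    using that
  proof (induction i rule: dec_induct)
    case (step i)
    then show ?case using assms(2,3)[of i] by linarith
  qed (use assms(1) in simp)
  have b_pos: "0 < b i" if "1 \<le> i" for i
    using a_pos[OF that] assms(2)[OF that] by linarith
  \<comment> \<open>The first summand is the size that \<open>dominated_region\<close> asks for when the exempt coordinate is at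
    most \<open>b i\<close>; the others absorb the original coordinate to which \<open>f\<close> is added.\<close>
  define C where "C i = 2 ^ n * (1 + 2 ^ n + b i) + b i + c i" for i
  obtain f where f: "f holomorphic_on UNIV"
    "\<And>k \<zeta>. a (Suc k) \<le> norm \<zeta> \<Longrightarrow> norm \<zeta> \<le> b (Suc k) \<Longrightarrow> C (Suc k) \<le> norm (f \<zeta>)"
  proof (rule entire_function_large_on_annuli[of "\<lambda>k. b (Suc k)" "\<lambda>k. a (Suc k)" "\<lambda>k. C (Suc k)"])
    show "filterlim (\<lambda>k. b (Suc k)) at_top sequentially"
      using assms(6) by (rule filterlim_compose[OF _ filterlim_Suc])
  qed (use assms(2,3) b_pos in auto)
  obtain \<Psi> :: "complex ^ 'm option \<Rightarrow> complex ^ 'm option"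
    where \<Psi>: "holomorphic_map \<Psi>" "inj \<Psi>" "range \<Psi> \<inter> dominated_region n h = {}"
    by (rule entire_embedding_avoiding_dominated_region)
  obtain \<Theta> :: "complex ^ 'm option \<Rightarrow> complex ^ 'm option"
    where \<Theta>: "holomorphic_map \<Theta>" "inj \<Theta>" "\<And>x. x $ h 0 = \<Theta> x $ h 0"
    "\<And>x k. Suc k < n \<Longrightarrow> x $ h (Suc k) = \<Theta> x $ h (Suc k) + f (\<Theta> x $ h k)"
    by (rule triangular_automorphism[OF f(1)]) blast

  \<comment> \<open>A coordinate of \<open>z = \<Theta> x\<close> in the annulus makes \<open>f\<close> huge, so the next coordinate of \<open>x\<close> is huge;
    the exempt coordinate is unchanged and hence at most \<open>b i\<close>.\<close>
  have K_region: "x \<in> dominated_region n h" if "\<Theta> x \<in> K" for x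
  proof -
    define z where "z = \<Theta> x"
    obtain i where i: "1 \<le> i" and z: "z \<in> times_last
               ((*\<^sub>R) (b i) ` closed_polydisk - (*\<^sub>R) (a i) ` open_polydisk) ((*\<^sub>R) (c i) ` cball 0 1)"
      using \<open>\<Theta> x \<in> K\<close> unfolding assms(7) z_def by auto
    note bounds = shell_times_disc_bounds[OF z a_pos[OF i] assms(2)[OF i] assms(4)[OF i]]
    obtain j where j: "a i \<le> norm (z $ Some j)" using bounds(3) by blast
    define k where "k = p (Some j)"
    have k: "Suc k < n" "h k = Some j"
      using p_Some[of j] h_p[of "Some j"] by (simp_all add: k_def n_def)
    have "C i \<le> norm (f (z $ h k))"
      using f(2)[of "i - 1" "z $ Some j"] i j bounds(1)[of j] by (simp add: k)
    moreover have "norm (z $ h (Suc k)) \<le> b i + c i"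
    proof (cases "h (Suc k)")
      case None
      then show ?thesis using bounds(2) b_pos[OF i] by simp
    next
      case (Some j')
      then show ?thesis using bounds(1)[of j'] assms(4)[OF i] by simp
    qed
    moreover have "norm (f (z $ h k)) - norm (z $ h (Suc k)) \<le> norm (x $ h (Suc k))"
      using \<Theta>(4)[OF k(1), of x] norm_triangle_ineq2[of "f (z $ h k)" "- z $ h (Suc k)"]
      by (simp add: z_def add.commute)
    ultimately have large: "2 ^ n * (1 + 2 ^ n + b i) \<le> norm (x $ h (Suc k))"
      unfolding C_def by linarith
    have "norm (x $ h 0) \<le> b i"
    proof (cases "h 0")
      case None
      then have "p (h 0) = N" by (simp add: p_None)
      then show ?thesis by (simp add: p_h n_def N_def)
    next
      case (Some j')
      then show ?thesis using bounds(1)[of j'] \<Theta>(3)[of x] by (simp add: z_def)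
    qed
    then have "2 ^ (n - Suc k) * max (1 + 2 ^ n) (norm (x $ h 0)) \<le> 2 ^ n * (1 + 2 ^ n + b i)"
      using b_pos[OF i] by (intro mult_mono power_increasing) (auto simp: add_increasing le_max_iff_disj)
    then show ?thesis
      using large k(1) unfolding dominated_region_def by (auto intro!: bexI[of _ "Suc k"])
  qed
  define F where "F y = \<Theta> (\<Psi> y)" for y
  have F_K: "F y \<notin> K" for y
    using K_region[of "\<Psi> y"] \<Psi>(3) by (auto simp: F_def)
  obtain x where "x \<notin> range \<Psi>"
    using dominated_region_nonempty \<Psi>(3) by blast
  then have "\<Theta> x \<notin> range F"
    using \<Theta>(2) by (auto simp: F_def inj_eq)
  moreover have "holomorphic_map F"
    unfolding F_def[abs_def] by (rule holomorphic_map_compose[OF \<Psi>(1) \<Theta>(1)])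
  moreover have "inj F"
    using inj_compose[OF \<Theta>(2) \<Psi>(2)] by (simp add: F_def[abs_def] o_def)
  ultimately have "fatou_bieberbach_domain (range F)"
    by (intro fatou_bieberbach_domain_range) auto
  then show ?thesis using F_K by blast
qed

end
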